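(* Let $p,q\in(1,+\infty)$ with $1/p+1/q=1$. Suppose that $\mathbf{v}_j=[v_{j,k}:k\in\mathbb{N}]$, $j=1,\dots,n$, are linearly independent elements of $\ell_q(\mathbb{N})$, that $\mathbf{y}\in\mathbb{R}^n\setminus\{\mathbf{0}\}$, and that $\hat{\mathbf{x}}_p$ is the unique solution of the minimum norm interpolation problem $$\inf\Bigl\{\|\mathbf{x}\|_p:\mathbf{x}\in\ell_p(\mathbb{N}),\ \sum_{k\in\mathbb{N}}v_{j,k}x_k=y_j,\ j=1,\dots,n\Bigr\}.$$ If there exists $N\in\mathbb{N}$ such that $\mathrm{supp}(\hat{\mathbf{x}}_p)\subset\{1,\dots,N\}$, then $\mathcal{T}_N(\mathbf{v}_1),\dots,\mathcal{T}_N(\mathbf{v}_n)$ are linearly dependent.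
   Context: $\ell_p(\mathbb{N})$ is the usual real sequence space with norm $\|\mathbf{x}\|_p=(\sum_{j\in\mathbb{N}}|x_j|^p)^{1/p}$, with $\mathbb{N}=\{1,2,\dots\}$. For a sequence $\mathbf{x}=[x_k:k\in\mathbb{N}]$, $\mathrm{supp}(\mathbf{x}):=\{j\in\mathbb{N}:x_j\neq0\}$ and, for $N\in\mathbb{N}$, $\mathcal{T}_N(\mathbf{x}):=[x_{N+k}:k\in\mathbb{N}]$. *)

theory Defs
  imports "HOL-Analysis.Analysis"
begin

text \<open>
  A real sequence \<open>[x\<^sub>1, x\<^sub>2, \<dots>]\<close> is a function on \<open>nat\<close>, with \<open>x\<^sub>k\<close> stored at
  position \<open>k - 1\<close>. Hence \<open>{1,\<dots>,N}\<close> becomes \<open>{..<N}\<close>, and the shift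
  \<open>[x\<^sub>N\<^sub>+\<^sub>k : k \<ge> 1]\<close> becomes \<open>\<lambda>k. x (N + k)\<close>.
\<close>

definition lp_space :: "real \<Rightarrow> (nat \<Rightarrow> real) set" where
  "lp_space p = {x. summable (\<lambda>k. \<bar>x k\<bar> powr p)}"

definition lp_norm :: "real \<Rightarrow> (nat \<Rightarrow> real) \<Rightarrow> real" where
  "lp_norm p x = (\<Sum>k. \<bar>x k\<bar> powr p) powr (1 / p)"

definition seq_support :: "(nat \<Rightarrow> real) \<Rightarrow> nat set" where
  "seq_support x = {k. x k \<noteq> 0}"

definition seq_shift :: "nat \<Rightarrow> (nat \<Rightarrow> real) \<Rightarrow> nat \<Rightarrow> real" where
  "seq_shift N x = (\<lambda>k. x (N + k))"

text \<open>
  Linear independence of a finite family of sequences. In contrast to the set-based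
  notion \<^const>\<open>independent\<close>, a family with a repeated member is dependent.
\<close>

definition lin_independent_family :: "('n::finite \<Rightarrow> nat \<Rightarrow> real) \<Rightarrow> bool" where
  "lin_independent_family v \<longleftrightarrow>
     (\<forall>c :: 'n \<Rightarrow> real. (\<forall>k. (\<Sum>j\<in>UNIV. c j * v j k) = 0) \<longrightarrow> (\<forall>j. c j = 0))"

abbreviation lin_dependent_family :: "('n::finite \<Rightarrow> nat \<Rightarrow> real) \<Rightarrow> bool" where
  "lin_dependent_family v \<equiv> \<not> lin_independent_family v"

definition interpolants :: "real \<Rightarrow> ('n::finite \<Rightarrow> nat \<Rightarrow> real) \<Rightarrow> real ^ 'n \<Rightarrow> (nat \<Rightarrow> real) set" where
  "interpolants p v y = {x \<in> lp_space p. \<forall>j. (\<lambda>k. v j k * x k) sums (y $ j)}"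

definition min_norm_interpolant ::
    "real \<Rightarrow> ('n::finite \<Rightarrow> nat \<Rightarrow> real) \<Rightarrow> real ^ 'n \<Rightarrow> (nat \<Rightarrow> real) \<Rightarrow> bool" where
  "min_norm_interpolant p v y x \<longleftrightarrow> is_arg_min (lp_norm p) (\<lambda>z. z \<in> interpolants p v y) x"

definition unique_min_norm_interpolant ::
    "real \<Rightarrow> ('n::finite \<Rightarrow> nat \<Rightarrow> real) \<Rightarrow> real ^ 'n \<Rightarrow> (nat \<Rightarrow> real) \<Rightarrow> bool" where
  "unique_min_norm_interpolant p v y x \<longleftrightarrow>
     min_norm_interpolant p v y x \<and> (\<forall>z. min_norm_interpolant p v y z \<longrightarrow> z = x)"

end

theory Submission
  imports Defs
begin

text \<open>
  Suppose that the tails \<open>T\<^sub>N(v\<^sub>j)\<close> were independent.  Their columns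
  \<open>[v\<^bsub>j,N+k\<^esub> : j]\<close> would then span \<open>\<real>\<^sup>n\<close>, so the data \<open>y\<close> could be interpolated by a finitely
  supported sequence \<open>u\<close> living beyond \<open>N\<close> (lemma \<open>finitely_supported_interpolation\<close>), hence with
  support disjoint from that of the minimizer \<open>x\<close>.

  This contradicts minimality.  Every \<open>(1 - t) x + t u\<close> is again an interpolant, and because of
  the disjoint supports its norm satisfies
  \<open>\<parallel>(1 - t) x + t u\<parallel>\<^sup>p = (1 - t)\<^sup>p \<parallel>x\<parallel>\<^sup>p + t\<^sup>p \<parallel>u\<parallel>\<^sup>p\<close>.  As \<open>p > 1\<close>, for small \<open>t > 0\<close> the gain in the
  first term is of order \<open>t\<close> while the cost \<open>t\<^sup>p \<parallel>u\<parallel>\<^sup>p\<close> is of smaller order, so the norm drops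
  below \<open>\<parallel>x\<parallel>\<close>; here \<open>x \<noteq> 0\<close> because \<open>y \<noteq> 0\<close>.  Thus a nonzero minimizer shares a support point with
  every interpolant (lemma \<open>min_norm_interpolant_support_meets\<close>).
\<close>

text \<open>
  Independent rows have spanning columns: a vector \<open>a \<noteq> 0\<close> orthogonal to all columns
  would be a nontrivial relation \<open>a\<close> between the rows.
\<close>

lemma finitely_supported_interpolation:
  fixes w :: "'n::finite \<Rightarrow> nat \<Rightarrow> real" and y :: "real ^ 'n"
  assumes "lin_independent_family w"
  obtains u where "finite (seq_support u)" "\<And>j. (\<lambda>k. w j k * u k) sums (y $ j)"
proof -
  define c :: "nat \<Rightarrow> real ^ 'n" where "c = (\<lambda>k. \<chi> j. w j k)"
  have "span (range c) = UNIV"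
  proof (rule ccontr)
    assume "span (range c) \<noteq> UNIV"
    then obtain a where "a \<noteq> 0" and a: "\<And>z. z \<in> span (range c) \<Longrightarrow> a \<bullet> z = 0"
      using span_not_univ_subset_hyperplane[of "range c"] by blast
    have "(\<Sum>j\<in>UNIV. a $ j * w j k) = 0" for k
      using a[of "c k"] by (simp add: span_base inner_vec_def c_def)
    then have "a $ j = 0" for j
      using assms unfolding lin_independent_family_def by blast
    with \<open>a \<noteq> 0\<close> show False by (simp add: vec_eq_iff)
  qed
  then obtain t r where t: "finite t" "t \<subseteq> range c" "y = (\<Sum>b\<in>t. r b *\<^sub>R b)"
    unfolding span_explicit by blast
  then obtain K where K: "inj_on c K" "t = c ` K"
    by (metis subset_image_inj)
  with t have fin: "finite K" by (simp add: finite_image_iff)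
  have y: "y = (\<Sum>k\<in>K. r (c k) *\<^sub>R c k)"
    using t(3) K by (simp add: sum.reindex)
  define u where "u = (\<lambda>k. if k \<in> K then r (c k) else 0)"
  have "finite (seq_support u)"
    using fin by (rule finite_subset[rotated]) (auto simp: seq_support_def u_def)
  moreover have "(\<lambda>k. w j k * u k) sums (y $ j)" for j
  proof -
    have "y $ j = (\<Sum>k\<in>K. w j k * u k)"
      unfolding y by (simp add: c_def u_def mult.commute cong: sum.cong)
    then show ?thesis
      using sums_finite[OF fin, of "\<lambda>k. w j k * u k"] by (simp add: u_def)
  qed
  ultimately show thesis by (rule that)
qed

text \<open>
  The scalar form of the descent: the gain \<open>A - (1 - t)\<^sup>p A\<close> is at least \<open>t A\<close>, which beats
  the cost \<open>t\<^sup>p B\<close> as soon as \<open>t\<^bsup>p-1\<^esup> B < A\<close>.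
\<close>

lemma convex_step_decreases:
  fixes p A B :: real
  assumes "1 < p" "0 < A" "0 \<le> B"
  obtains t where "0 < t" "t \<le> 1" "(1 - t) powr p * A + t powr p * B < A"
proof -
  define t where "t = min 1 ((A / (B + 1)) powr (1 / (p - 1)))"
  have t: "0 < t" "t \<le> 1" using assms by (auto simp: t_def)
  have "t powr (p - 1) \<le> ((A / (B + 1)) powr (1 / (p - 1))) powr (p - 1)"
    using t assms by (intro powr_mono2) (auto simp: t_def)
  also have "\<dots> = A / (B + 1)"
    using assms by (simp add: powr_powr)
  finally have "t powr (p - 1) * B \<le> A / (B + 1) * B"
    using assms by (intro mult_right_mono) auto
  also have "\<dots> < A" using assms by (simp add: field_simps)
  finally have "t * (t powr (p - 1) * B) < t * A" using t by simp
  moreover have "t powr p = t * t powr (p - 1)"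
    using t by (simp add: powr_diff)
  ultimately have cost: "t powr p * B < t * A" by (simp add: mult.assoc)
  have "(1 - t) powr p \<le> (1 - t) powr 1"
    using t assms by (intro powr_mono') auto
  then have "(1 - t) powr p * A \<le> (1 - t) * A"
    using t assms by (intro mult_right_mono) auto
  with cost have "(1 - t) powr p * A + t powr p * B < A"
    by (simp add: algebra_simps)
  with t show thesis by (rule that)
qed

text \<open>
  On disjoint supports the \<open>p\<close>-th powers of norms add up, so moving from \<open>x\<close> towards a
  disjointly supported interpolant \<open>u\<close> would lower the norm.
\<close>

lemma min_norm_interpolant_support_meets:
  fixes v :: "'n::finite \<Rightarrow> nat \<Rightarrow> real"
  assumes p: "1 < p"
    and x: "min_norm_interpolant p v y x" "seq_support x \<noteq> {}"
    and u: "u \<in> interpolants p v y"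
  shows "seq_support x \<inter> seq_support u \<noteq> {}"
proof
  assume disj: "seq_support x \<inter> seq_support u = {}"
  define A where "A = (\<Sum>k. \<bar>x k\<bar> powr p)"
  define B where "B = (\<Sum>k. \<bar>u k\<bar> powr p)"
  have x_int: "x \<in> interpolants p v y"
    and least: "\<And>z. z \<in> interpolants p v y \<Longrightarrow> \<not> lp_norm p z < lp_norm p x"
    using x(1) by (auto simp: min_norm_interpolant_def is_arg_min_def)
  have sx: "summable (\<lambda>k. \<bar>x k\<bar> powr p)" and su: "summable (\<lambda>k. \<bar>u k\<bar> powr p)"
    using x_int u by (auto simp: interpolants_def lp_space_def)
  obtain i where "x i \<noteq> 0" using x(2) by (auto simp: seq_support_def)
  then have "A > 0"
    unfolding A_def using suminf_pos2[OF sx, of i] by simp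
  moreover have "B \<ge> 0" unfolding B_def using su by (simp add: suminf_nonneg)
  ultimately obtain t where t: "0 < t" "t \<le> 1" "(1 - t) powr p * A + t powr p * B < A"
    using convex_step_decreases[OF p] by blast
  define z where "z = (\<lambda>k. (1 - t) * x k + t * u k)"
  have split: "\<bar>z k\<bar> powr p = (1 - t) powr p * \<bar>x k\<bar> powr p + t powr p * \<bar>u k\<bar> powr p" for k
  proof -
    have "x k = 0 \<or> u k = 0" using disj by (auto simp: seq_support_def)
    then show ?thesis using t p by (auto simp: z_def abs_mult powr_mult)
  qed
  have "(\<lambda>k. \<bar>z k\<bar> powr p) sums ((1 - t) powr p * A + t powr p * B)"
    unfolding split A_def B_def
    by (intro sums_add sums_mult summable_sums sx su)
  then have z_sum: "summable (\<lambda>k. \<bar>z k\<bar> powr p)"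
    and z_norm: "(\<Sum>k. \<bar>z k\<bar> powr p) = (1 - t) powr p * A + t powr p * B"
    by (auto simp: sums_iff)
  have "(\<lambda>k. v j k * z k) sums (y $ j)" for j
  proof -
    have "(\<lambda>k. (1 - t) * (v j k * x k) + t * (v j k * u k)) sums ((1 - t) * y $ j + t * y $ j)"
      using x_int u by (intro sums_add sums_mult) (auto simp: interpolants_def)
    then show ?thesis by (simp add: z_def algebra_simps)
  qed
  with z_sum have "z \<in> interpolants p v y"
    by (simp add: interpolants_def lp_space_def)
  moreover have "lp_norm p z < lp_norm p x"
    unfolding lp_norm_def z_norm A_def[symmetric]
    using t p \<open>A > 0\<close> \<open>B \<ge> 0\<close> by (intro powr_less_mono2) auto
  ultimately show False using least by blast
qed

theorem proposition21:
  fixes p q :: real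
    and v :: "'n::finite \<Rightarrow> nat \<Rightarrow> real"
    and y :: "real ^ 'n"
    and xhat :: "nat \<Rightarrow> real"
    and N :: nat
  assumes "1 < p" and "1 < q" and "1 / p + 1 / q = 1"
    and "\<And>j. v j \<in> lp_space q"
    and "lin_independent_family v"
    and "y \<noteq> 0"
    and "unique_min_norm_interpolant p v y xhat"
    and "N \<ge> 1"
    and "seq_support xhat \<subseteq> {..<N}"
  shows "lin_dependent_family (\<lambda>j. seq_shift N (v j))"
proof
  assume "lin_independent_family (\<lambda>j. seq_shift N (v j))"
  then obtain w where w: "finite (seq_support w)"
      "\<And>j. (\<lambda>k. seq_shift N (v j) k * w k) sums (y $ j)"
    using finitely_supported_interpolation by blast
  define u where "u = (\<lambda>k. if k < N then 0 else w (k - N))"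
  have u_shift: "u (k + N) = w k" for k by (simp add: u_def)
  have u_zero: "u k = 0" if "k < N" for k using that by (simp add: u_def)
  have "summable (\<lambda>k. \<bar>w k\<bar> powr p)"
    using w(1) by (rule summable_finite) (simp add: seq_support_def)
  then have "summable (\<lambda>k. \<bar>u (k + N)\<bar> powr p)" by (simp add: u_shift)
  then have "u \<in> lp_space p"
    unfolding lp_space_def mem_Collect_eq by (rule summable_iff_shift[THEN iffD1])
  moreover have "(\<lambda>k. v j k * u k) sums (y $ j)" for j
  proof -
    have "(\<lambda>k. v j (k + N) * u (k + N)) sums (y $ j)"
      using w(2)[of j] by (simp add: seq_shift_def u_shift add.commute)
    then show ?thesis by (subst sums_zero_iff_shift[symmetric]) (auto simp: u_zero)
  qed
  ultimately have "u \<in> interpolants p v y" by (simp add: interpolants_def)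
  moreover have min: "min_norm_interpolant p v y xhat"
    using assms(7) by (simp add: unique_min_norm_interpolant_def)
  moreover have "seq_support xhat \<noteq> {}"
  proof
    assume "seq_support xhat = {}"
    then have "(\<lambda>k. v j k * xhat k) = (\<lambda>k. 0)" for j by (auto simp: seq_support_def)
    then have "y $ j = 0" for j
      using min sums_unique2[OF _ sums_zero]
      by (force simp: min_norm_interpolant_def is_arg_min_def interpolants_def)
    with \<open>y \<noteq> 0\<close> show False by (simp add: vec_eq_iff)
  qed
  ultimately have "seq_support xhat \<inter> seq_support u \<noteq> {}"
    using min_norm_interpolant_support_meets[OF \<open>1 < p\<close>] by blast
  moreover have "seq_support u \<subseteq> {N..}"
    using u_zero by (auto simp: seq_support_def not_less[symmetric])
  ultimately show False using assms(9) by fastforce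
qed

end
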